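(* There are infinitely many strong Skolem starters that are not cardioidal, and there are infinitely many skew Skolem starters that are not cardioidal.
   Context: For an odd integer $n=2q+1\ge 3$, let $\mathbb{Z}_n^*$ denote the nonzero integers modulo $n$, ordered $1<2<\dots<2q$. A 2-partition of $\mathbb{Z}_n^*$ is a partition of $\mathbb{Z}_n^*$ into $q$ unordered pairs $\{x_i,y_i\}$. Such a 2-partition is: a starter in $\mathbb{Z}_n$ if $\{\pm(x_i-y_i) \bmod n : 1\le i\le q\}=\mathbb{Z}_n^*$; strong if the sums $x_i+y_i \pmod n$ are all nonzero and pairwise distinct; skew if $\{\pm(x_i+y_i)\bmod n : 1\le i\le q\}=\mathbb{Z}_n^*$; Skolem if every pair $\{x,y\}$ with $y>x$ satisfies $y-x\le q$ (equivalently, for each $i=1,\dots,q$ there is a pair $(s_i,t_i)$ with $t_i>s_i$ and $t_i-s_i=i$); cardioidal if every pair has the form $\{i,2i \bmod n\}$ for some $i\in\mathbb{Z}_n^*$. A strong (resp. skew) Skolem starter is a starter that is strong (resp. skew) and Skolem. It is known (from prior work of the authors) that there are infinitely many strong cardioidal starters and that each is skew and Skolem; they exist exactly for orders in the multiplicative closure of the primes $p>3$ with $\mathrm{ord}_p(2)\equiv 2 \pmod 4$, an infinite set. *)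

theory Defs
  imports Main "HOL-Library.Disjoint_Sets"
begin

text \<open>
  Residues modulo an odd \<open>n = 2q + 1\<close> are represented by the integers \<open>0, \<dots>, n - 1\<close>, so that the
  order \<open>1 < 2 < \<dots> < 2q\<close> on the nonzero residues is the order of \<open>int\<close>. An unordered pair is
  a two-element set.
\<close>

definition nonzero_residues :: "int \<Rightarrow> int set" where
  "nonzero_residues n = {1..n - 1}"

definition two_partition :: "int \<Rightarrow> int set set \<Rightarrow> bool" where
  "two_partition n P \<longleftrightarrow> partition_on (nonzero_residues n) P \<and> (\<forall>A\<in>P. card A = 2)"

definition starter :: "int \<Rightarrow> int set set \<Rightarrow> bool" where
  "starter n P \<longleftrightarrow> two_partition n P \<and>
     (\<Union>(x, y)\<in>{(x, y). {x, y} \<in> P}. {(x - y) mod n, (- (x - y)) mod n}) = nonzero_residues n"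

text \<open>For a two-element set \<open>A = {x, y}\<close>, the sum \<open>\<Sum>A\<close> is \<open>x + y\<close>.\<close>

definition strong :: "int \<Rightarrow> int set set \<Rightarrow> bool" where
  "strong n P \<longleftrightarrow> (\<forall>A\<in>P. (\<Sum>A) mod n \<noteq> 0) \<and> inj_on (\<lambda>A. (\<Sum>A) mod n) P"

definition skew :: "int \<Rightarrow> int set set \<Rightarrow> bool" where
  "skew n P \<longleftrightarrow> (\<Union>A\<in>P. {(\<Sum>A) mod n, (- \<Sum>A) mod n}) = nonzero_residues n"

text \<open>The difference \<open>y - x\<close> is taken in the integers, not modulo \<open>n\<close>; the bound is \<open>q\<close>.\<close>

definition skolem :: "int \<Rightarrow> int set set \<Rightarrow> bool" where
  "skolem n P \<longleftrightarrow> (\<forall>x y. {x, y} \<in> P \<and> x < y \<longrightarrow> y - x \<le> (n - 1) div 2)"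

definition cardioidal :: "int \<Rightarrow> int set set \<Rightarrow> bool" where
  "cardioidal n P \<longleftrightarrow> (\<forall>A\<in>P. \<exists>i\<in>nonzero_residues n. A = {i, (2 * i) mod n})"

definition strong_skolem_starter :: "int \<Rightarrow> int set set \<Rightarrow> bool" where
  "strong_skolem_starter n P \<longleftrightarrow> starter n P \<and> strong n P \<and> skolem n P"

definition skew_skolem_starter :: "int \<Rightarrow> int set set \<Rightarrow> bool" where
  "skew_skolem_starter n P \<longleftrightarrow> starter n P \<and> skew n P \<and> skolem n P"

end

theory Submission
  imports Defs
begin

text \<open>
  If \<open>P\<close> is a skew Skolem starter of odd order \<open>n\<close> prime to 3, a skew Skolem starter of order
  \<open>11n\<close> is obtained by scaling \<open>P\<close> by 11, which handles the multiples of 11, and adjoining the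
  pairs \<open>{i, 2i}\<close> for all \<open>i\<close> that are squares modulo 11. Since 2 and -1 are non-squares modulo
  11, these pairs partition the residues prime to 11, and their differences \<open>\<plusminus>i\<close> and sums
  \<open>\<plusminus>3i\<close> cover those residues. The Skolem condition holds for every pair \<open>{i, 2i}\<close>, because
  its integer difference is \<open>i\<close> if \<open>2i < N\<close> and \<open>N - i\<close> otherwise. A pair of \<open>P\<close> that is not
  of the form \<open>{i, 2i}\<close> stays so after scaling. Iterating from a starter of order 17, found by
  computer search, gives one starter for each order \<open>17 * 11^k\<close>. Skew starters are strong.
\<close>

section \<open>Criteria for starters and skew partitions\<close>

text \<open>Distinct elements of \<open>{1..n - 1}\<close> never differ by a multiple of
  \<open>n\<close>, so only coverage is left to check. Letting \<open>x\<close> and \<open>y\<close>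
  range over the pair in both orders accounts for the sign, and the case \<open>x = y\<close> is
  harmless because \<open>d\<close> is nonzero.\<close>

lemma starter_iff:
  assumes "two_partition n P" "n \<ge> 2"
  shows "starter n P \<longleftrightarrow> (\<forall>d\<in>{1..n - 1}. \<exists>A\<in>P. \<exists>x\<in>A. \<exists>y\<in>A. (x - y) mod n = d)"
proof -
  have P: "\<Union>P = {1..n - 1}" "\<And>A. A \<in> P \<Longrightarrow> card A = 2"
    using assms(1) by (auto simp: two_partition_def nonzero_residues_def partition_on_def)
  let ?D = "\<Union>(x, y)\<in>{(x, y). {x, y} \<in> P}. {(x - y) mod n, (- (x - y)) mod n}"
  have D: "d \<in> ?D \<longleftrightarrow> (\<exists>x y. {x, y} \<in> P \<and> (x - y) mod n = d)" for d
  proof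
    assume "d \<in> ?D"
    then obtain x y where "{x, y} \<in> P" "d = (x - y) mod n \<or> d = (y - x) mod n" by auto
    then show "\<exists>x y. {x, y} \<in> P \<and> (x - y) mod n = d" by (metis insert_commute)
  next
    assume "\<exists>x y. {x, y} \<in> P \<and> (x - y) mod n = d"
    then obtain x y where xy: "{x, y} \<in> P" "(x - y) mod n = d" by blast
    then show "d \<in> ?D" by (intro UN_I[of "(x, y)"]) simp_all
  qed
  have sub: "?D \<subseteq> {1..n - 1}"
  proof
    fix d assume "d \<in> ?D"
    then obtain x y where xy: "{x, y} \<in> P" "(x - y) mod n = d" using D by blast
    have "x \<in> {1..n - 1}" "y \<in> {1..n - 1}" "x \<noteq> y"
      using xy(1) P(1) P(2)[OF xy(1)] by (auto simp: card_insert_if split: if_splits)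
    then have "(x - y) mod n \<noteq> 0"
      using dvd_imp_le_int[of "x - y" n] by (auto simp: mod_eq_0_iff_dvd)
    moreover have "0 \<le> (x - y) mod n" "(x - y) mod n < n"
      using assms(2) by auto
    ultimately show "d \<in> {1..n - 1}" using xy(2) by auto
  qed
  have E: "d \<in> ?D \<longleftrightarrow> (\<exists>A\<in>P. \<exists>x\<in>A. \<exists>y\<in>A. (x - y) mod n = d)" if "d \<in> {1..n - 1}" for d
    unfolding D
  proof
    assume "\<exists>A\<in>P. \<exists>x\<in>A. \<exists>y\<in>A. (x - y) mod n = d"
    then obtain A x y where A: "A \<in> P" "x \<in> A" "y \<in> A" "(x - y) mod n = d" by blast
    then have "x \<noteq> y" using that by auto
    then have "A = {x, y}" using A P(2)[OF A(1)] by (auto simp: card_2_iff)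
    then show "\<exists>x y. {x, y} \<in> P \<and> (x - y) mod n = d" using A by blast
  qed (metis insertI1 insertI2)
  have "{1..n - 1} \<subseteq> ?D \<longleftrightarrow> (\<forall>d\<in>{1..n - 1}. \<exists>A\<in>P. \<exists>x\<in>A. \<exists>y\<in>A. (x - y) mod n = d)"
    unfolding subset_eq[of "{1..n - 1}"] by (intro ball_cong refl E)
  then show ?thesis
    using sub assms(1) by (simp only: starter_def nonzero_residues_def set_eq_subset simp_thms)
qed

text \<open>Unlike a difference, the sum of a pair can vanish modulo \<open>n\<close>, so
  nonvanishing stays as a separate condition beside coverage. The bounded quantifiers allow direct
  evaluation on a concrete partition.\<close>

lemma skew_iff:
  assumes "n \<ge> 2"
  shows "skew n P \<longleftrightarrow> (\<forall>A\<in>P. (\<Sum>A) mod n \<noteq> 0) \<and>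
    (\<forall>d\<in>{1..n - 1}. \<exists>A\<in>P. (\<Sum>A) mod n = d \<or> (- \<Sum>A) mod n = d)" (is "_ \<longleftrightarrow> ?R")
proof -
  have nz: "z mod n \<in> {1..n - 1} \<longleftrightarrow> z mod n \<noteq> 0" for z
    using assms pos_mod_bound[of n z] pos_mod_sign[of n z] unfolding atLeastAtMost_iff by linarith
  have nz': "(- z) mod n \<in> {1..n - 1} \<longleftrightarrow> z mod n \<noteq> 0" for z
    unfolding nz by (simp add: mod_eq_0_iff_dvd)
  let ?S = "\<Union>A\<in>P. {(\<Sum>A) mod n, (- \<Sum>A) mod n}"
  have "?S \<subseteq> {1..n - 1} \<longleftrightarrow> (\<forall>A\<in>P. (\<Sum>A) mod n \<noteq> 0)"
    unfolding UN_subset_iff insert_subset nz nz' by (simp add: mod_eq_0_iff_dvd)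
  moreover have "{1..n - 1} \<subseteq> ?S \<longleftrightarrow>
      (\<forall>d\<in>{1..n - 1}. \<exists>A\<in>P. (\<Sum>A) mod n = d \<or> (- \<Sum>A) mod n = d)"
    unfolding subset_eq[of "{1..n - 1}"] by (intro ball_cong refl) auto
  ultimately show ?thesis
    by (simp only: skew_def nonzero_residues_def set_eq_subset)
qed

text \<open>The \<open>q\<close> pairs contribute at most two residues \<open>\<plusminus>s\<close> each, so hitting all \<open>2q\<close> nonzero residues
  leaves no room for a repeated sum.\<close>

lemma skew_imp_strong:
  assumes tp: "two_partition n P" and sk: "skew n P" and n: "n \<ge> 2"
  shows "strong n P"
proof -
  have P: "\<Union>P = {1..n - 1}" "\<And>A. A \<in> P \<Longrightarrow> card A = 2" "disjoint P"
    using tp by (auto simp: two_partition_def nonzero_residues_def partition_on_def)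
  have fin: "finite P" using P(1) by (metis finite_UnionD finite_atLeastAtMost_int)
  have cardP: "2 * card P = nat (n - 1)"
    using card_partition[of P 2] fin P by (simp add: disjoint_def)
  let ?f = "\<lambda>A. {(\<Sum>A) mod n, (- \<Sum>A) mod n}"
  have "inj_on (\<lambda>A. (\<Sum>A) mod n) P"
  proof (rule inj_onI, rule ccontr)
    fix A B assume AB: "A \<in> P" "B \<in> P" "(\<Sum>A) mod n = (\<Sum>B) mod n" "A \<noteq> B"
    then have "?f A = ?f B" by (metis mod_minus_eq)
    then have "(\<Union>A\<in>P. ?f A) = (\<Union>A\<in>P - {B}. ?f A)" using AB by blast
    then have "nat (n - 1) = card (\<Union>A\<in>P - {B}. ?f A)"
      using sk by (simp add: skew_def nonzero_residues_def)
    also have "\<dots> \<le> (\<Sum>A\<in>P - {B}. card (?f A))"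
      using fin by (intro card_UN_le) auto
    also have "\<dots> \<le> (\<Sum>A\<in>P - {B}. 2)" by (intro sum_mono) (auto simp: card_insert_if)
    also have "\<dots> < 2 * card P"
      using card_Diff1_less[OF fin AB(2)] by simp
    finally show False using cardP by simp
  qed
  then show ?thesis using sk n by (simp add: strong_def skew_iff)
qed

section \<open>The extension by 11 and arithmetic modulo 11\<close>

text \<open>The invariant of the iteration. An order prime to 3 makes 3 invertible modulo
  \<open>11 * n\<close>, which lets the sums \<open>3 * i\<close> of the new pairs reach every
  residue prime to 11.\<close>

definition skew_skolem_noncard :: "int \<Rightarrow> int set set \<Rightarrow> bool" where
  "skew_skolem_noncard n P \<longleftrightarrow> odd n \<and> n \<ge> 3 \<and> \<not> 3 dvd n \<and>
     skew_skolem_starter n P \<and> \<not> cardioidal n P"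

text \<open>The nonzero quadratic residues modulo 11; multiples of 11 belong neither here nor to
  \<open>nonsquare11\<close>.\<close>

definition square11 :: "int \<Rightarrow> bool" where
  "square11 x \<longleftrightarrow> x mod 11 \<in> {1, 3, 4, 5, 9}"

definition nonsquare11 :: "int \<Rightarrow> bool" where
  "nonsquare11 x \<longleftrightarrow> x mod 11 \<in> {2, 6, 7, 8, 10}"

text \<open>For \<open>N\<close> a multiple of 11, indexing by squares names each pair only once:
  its other element is a nonsquare, since 2 is.\<close>

definition doubling_pairs :: "int \<Rightarrow> int set set" where
  "doubling_pairs N = (\<lambda>i. {i, (2 * i) mod N}) ` {i \<in> {1..N - 1}. square11 i}"

definition extend :: "int \<Rightarrow> int set set \<Rightarrow> int set set" where
  "extend n P = (\<lambda>A. (*) 11 ` A) ` P \<union> doubling_pairs (11 * n)"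

lemma mod11_elem: "x mod 11 \<in> {0, 1, 2, 3, 4, 5, 6, 7, 8, 9, 10 :: int}"
proof -
  have "{0, 1, 2, 3, 4, 5, 6, 7, 8, 9, 10} = {0..10 :: int}"
    by (simp add: upto.simps flip: set_upto)
  then show ?thesis by simp
qed

lemma mod11_cases: "11 dvd x \<or> square11 x \<or> nonsquare11 x"
  using mod11_elem[of x] by (auto simp: square11_def nonsquare11_def dvd_eq_mod_eq_0)

lemma square11_not_dvd: "square11 x \<Longrightarrow> \<not> 11 dvd x"
  by (auto simp: square11_def dvd_eq_mod_eq_0)

lemma nonsquare11_not_dvd: "nonsquare11 x \<Longrightarrow> \<not> 11 dvd x"
  by (auto simp: nonsquare11_def dvd_eq_mod_eq_0)

lemma square11_nonsquare11: "square11 x \<Longrightarrow> \<not> nonsquare11 x"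
  by (auto simp: square11_def nonsquare11_def)

lemma square11_mod [simp]: "square11 (x mod (11 * n)) \<longleftrightarrow> square11 x"
  by (simp add: square11_def mod_mod_cancel)

lemma nonsquare11_mod [simp]: "nonsquare11 (x mod (11 * n)) \<longleftrightarrow> nonsquare11 x"
  by (simp add: nonsquare11_def mod_mod_cancel)

lemma nonsquare11_double [simp]: "nonsquare11 (2 * i) \<longleftrightarrow> square11 i"
proof -
  define r where "r = i mod 11"
  have "(2 * i) mod 11 = (2 * r) mod 11" by (simp add: r_def mod_mult_right_eq)
  moreover have "r \<in> {0, 1, 2, 3, 4, 5, 6, 7, 8, 9, 10}" unfolding r_def by (rule mod11_elem)
  ultimately show ?thesis
    unfolding square11_def nonsquare11_def r_def[symmetric] by (elim insertE emptyE) simp_all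
qed

lemma square11_minus [simp]: "square11 (- i) \<longleftrightarrow> nonsquare11 i"
proof -
  define r where "r = i mod 11"
  have "(- i) mod 11 = (- r) mod 11" by (simp add: r_def mod_minus_eq)
  moreover have "r \<in> {0, 1, 2, 3, 4, 5, 6, 7, 8, 9, 10}" unfolding r_def by (rule mod11_elem)
  ultimately show ?thesis
    unfolding square11_def nonsquare11_def r_def[symmetric] by (elim insertE emptyE) simp_all
qed

lemma mod_eq_of_dvd_diff:
  fixes d N :: int
  assumes "N dvd x - d" "d \<in> {1..N - 1}"
  shows "x mod N = d"
proof -
  have "x mod N = d mod N" using assms(1) by (simp add: mod_eq_dvd_iff)
  then show ?thesis using assms(2) by simp
qed

text \<open>Since \<open>2 * i < 2 * N\<close>, reduction subtracts \<open>N\<close> at most once;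
  this makes questions about doubled residues linear.\<close>

lemma double_mod_cases:
  fixes i N :: int
  assumes "i \<in> {1..N - 1}"
  shows "(2 * i) mod N = 2 * i \<and> 2 * i < N \<or> (2 * i) mod N = 2 * i - N \<and> N \<le> 2 * i"
proof (cases "2 * i < N")
  case True then show ?thesis using assms by simp
next
  case False
  then have "(2 * i) mod N = (2 * i - N) mod N" by simp
  also have "\<dots> = 2 * i - N" using False assms by (intro mod_pos_pos_trivial) auto
  finally show ?thesis using False assms by simp
qed

lemma doubling_pairE:
  assumes "A \<in> doubling_pairs (11 * n)"
  obtains i where "i \<in> {1..11 * n - 1}" "square11 i" "A = {i, (2 * i) mod (11 * n)}"
    "(2 * i) mod (11 * n) \<in> {1..11 * n - 1}" "nonsquare11 ((2 * i) mod (11 * n))"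
proof -
  obtain i where i: "i \<in> {1..11 * n - 1}" "square11 i" "A = {i, (2 * i) mod (11 * n)}"
    using assms unfolding doubling_pairs_def by blast
  then have *: "nonsquare11 ((2 * i) mod (11 * n))" by simp
  then have "(2 * i) mod (11 * n) \<noteq> 0" using nonsquare11_not_dvd by force
  moreover have "0 \<le> (2 * i) mod (11 * n)" "(2 * i) mod (11 * n) < 11 * n" using i(1) by auto
  ultimately have "(2 * i) mod (11 * n) \<in> {1..11 * n - 1}" by auto
  then show thesis using that i * by blast
qed

section \<open>Preservation of the properties under extension\<close>

text \<open>The class of an element modulo 11 decides where it lies: multiples of 11 in scaled
  pairs, squares as the index of a doubling pair, nonsquares as the doubled element.\<close>

lemma two_partition_extend:
  assumes tp: "two_partition n P" and n: "odd n" "n \<ge> 3"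
  shows "two_partition (11 * n) (extend n P)"
proof -
  let ?N = "11 * n"
  have P: "\<Union>P = {1..n - 1}" "\<And>A. A \<in> P \<Longrightarrow> card A = 2" "disjoint P" "{} \<notin> P"
    using tp by (auto simp: two_partition_def nonzero_residues_def partition_on_def)
  have card: "card A = 2" if A: "A \<in> extend n P" for A
  proof (cases "A \<in> doubling_pairs ?N")
    case True
    then obtain i where "square11 i" "A = {i, (2 * i) mod ?N}"
      "nonsquare11 ((2 * i) mod ?N)" by (rule doubling_pairE)
    then have "i \<noteq> (2 * i) mod ?N" using square11_nonsquare11 by metis
    then show ?thesis using \<open>A = _\<close> by simp
  next
    case False
    then obtain B where "B \<in> P" "A = (*) 11 ` B" using A by (auto simp: extend_def)
    then show ?thesis using P(2) by (simp add: card_image inj_on_def)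
  qed
  have sub: "A \<subseteq> {1..?N - 1}" if A: "A \<in> extend n P" for A
  proof (cases "A \<in> doubling_pairs ?N")
    case True
    then show ?thesis by (rule doubling_pairE) auto
  next
    case False
    then obtain B where "B \<in> P" "A = (*) 11 ` B" using A by (auto simp: extend_def)
    moreover from this have "B \<subseteq> {1..n - 1}" using P(1) by blast
    ultimately show ?thesis by fastforce
  qed
  have cover: "\<exists>A\<in>extend n P. x \<in> A" if x: "x \<in> {1..?N - 1}" for x
    using mod11_cases[of x]
  proof (elim disjE)
    assume "11 dvd x"
    then obtain y where y: "x = 11 * y" by blast
    then have "y \<in> \<Union>P" using x P(1) by auto
    then show ?thesis using y by (auto simp: extend_def)
  next
    assume "square11 x"
    then show ?thesis using x by (auto simp: extend_def doubling_pairs_def)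
  next
    assume m: "nonsquare11 x"
    \<comment> \<open>Halving modulo the odd \<open>11 * n\<close>: exactly one of \<open>x\<close>
      and \<open>x + 11 * n\<close> is even.\<close>
    obtain i where i: "2 * i = x \<or> 2 * i = x + ?N"
    proof (cases "even x")
      case False
      then have "even (x + ?N)" using n(1) by simp
      then show ?thesis using that by (metis dvdE)
    qed (use that in \<open>metis dvdE\<close>)
    have "i \<in> {1..?N - 1}" using i x by auto
    moreover have "(2 * i) mod ?N = x" using i x by auto
    moreover have "square11 i" using m \<open>(2 * i) mod ?N = x\<close> by (metis nonsquare11_double nonsquare11_mod)
    ultimately show ?thesis unfolding extend_def doubling_pairs_def by blast
  qed
  have disj: "A = B" if AB: "A \<in> extend n P" "B \<in> extend n P" "x \<in> A" "x \<in> B" for A B x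
  proof (cases "11 dvd x")
    case True
    have *: "\<exists>C\<in>P. A = (*) 11 ` C" if "A \<in> extend n P" "x \<in> A" for A
    proof (rule ccontr)
      assume "\<not> ?thesis"
      then have "A \<in> doubling_pairs ?N" using that by (auto simp: extend_def)
      then show False
        by (rule doubling_pairE) (use True that square11_not_dvd nonsquare11_not_dvd in blast)
    qed
    obtain C D where CD: "C \<in> P" "A = (*) 11 ` C" "D \<in> P" "B = (*) 11 ` D"
      using * AB by meson
    then obtain y where "y \<in> C" "y \<in> D" using AB by auto
    then show ?thesis using CD P(3) by (auto simp: disjoint_def)
  next
    case False
    have *: "A \<in> doubling_pairs ?N" if "A \<in> extend n P" "x \<in> A" for A
      using that False by (auto simp: extend_def)
    obtain i where i: "i \<in> {1..?N - 1}" "square11 i" "A = {i, (2 * i) mod ?N}"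
      "nonsquare11 ((2 * i) mod ?N)" using *[OF AB(1,3)] by (rule doubling_pairE)
    obtain j where j: "j \<in> {1..?N - 1}" "square11 j" "B = {j, (2 * j) mod ?N}"
      "nonsquare11 ((2 * j) mod ?N)" using *[OF AB(2,4)] by (rule doubling_pairE)
    \<comment> \<open>Being a square or a nonsquare, \<open>x\<close> occupies the same position in
      both pairs.\<close>
    have "x = i \<and> x = j \<or> x = (2 * i) mod ?N \<and> x = (2 * j) mod ?N"
      using i(2-4) j(2-4) AB(3,4) square11_nonsquare11 by (metis insertE singletonD)
    then have "i = j"
    proof
      assume "x = (2 * i) mod ?N \<and> x = (2 * j) mod ?N"
      then have eq: "(2 * i) mod ?N = (2 * j) mod ?N" by simp
      have "odd ?N" using n(1) by simp
      \<comment> \<open>Equal reductions could still differ by one wraparound, but an odd modulus is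
        not a difference of even numbers.\<close>
      moreover have "2 * i = 2 * j \<or> 2 * i = 2 * j + ?N \<or> 2 * j = 2 * i + ?N"
        using double_mod_cases[OF i(1)] double_mod_cases[OF j(1)] eq by linarith
      ultimately show "i = j" by presburger
    qed simp
    then show ?thesis using i j by simp
  qed
  have "{} \<notin> extend n P" using card[of "{}"] by auto
  moreover have "disjoint (extend n P)" using disj by (auto simp: disjoint_def)
  moreover have "\<Union>(extend n P) = {1..?N - 1}" using sub cover by blast
  ultimately show ?thesis
    using card by (simp add: two_partition_def nonzero_residues_def partition_on_def)
qed

text \<open>As -1 is a nonsquare modulo 11, one of \<open>e\<close> and \<open>- e\<close> is a
  square, and reduction modulo \<open>11 * n\<close> preserves its class. Thus every residue prime
  to 11 is, up to sign, the index of a doubling pair.\<close>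

lemma representative_up_to_sign:
  fixes e n :: int
  assumes "\<not> 11 dvd e" "n > 0"
  obtains i where "i \<in> {1..11 * n - 1}" "square11 i"
    "11 * n dvd i - e \<or> 11 * n dvd i + e"
proof -
  obtain f where f: "square11 f" "f = e \<or> f = - e"
    using mod11_cases[of e] assms(1) by (metis square11_minus)
  let ?i = "f mod (11 * n)"
  have sq: "square11 ?i" using f(1) by simp
  then have "?i \<noteq> 0" using square11_not_dvd by force
  moreover have "0 \<le> ?i" "?i < 11 * n" using assms(2) by auto
  ultimately have "?i \<in> {1..11 * n - 1}" by auto
  moreover have "11 * n dvd ?i - f" by (metis mod_eq_dvd_iff mod_mod_trivial)
  then have "11 * n dvd ?i - e \<or> 11 * n dvd ?i + e" using f(2) by auto
  ultimately show thesis using that sq by blast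
qed

lemma starter_extend:
  assumes st: "starter n P" and n: "odd n" "n \<ge> 3"
  shows "starter (11 * n) (extend n P)"
proof -
  let ?N = "11 * n"
  have tp: "two_partition n P" using st by (simp add: starter_def)
  have n2: "n \<ge> 2" using n(2) by simp
  have "\<exists>A\<in>extend n P. \<exists>x\<in>A. \<exists>y\<in>A. (x - y) mod ?N = d" if d: "d \<in> {1..?N - 1}" for d
  proof (cases "11 dvd d")
    case True
    then obtain e where e: "d = 11 * e" by blast
    then have "e \<in> {1..n - 1}" using d by auto
    then obtain A x y where xy: "A \<in> P" "x \<in> A" "y \<in> A" "(x - y) mod n = e"
      using st n(2) unfolding starter_iff[OF tp n2] by blast
    have "(*) 11 ` A \<in> extend n P" "11 * x \<in> (*) 11 ` A" "11 * y \<in> (*) 11 ` A"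
      using xy by (auto simp: extend_def)
    moreover have "(11 * x - 11 * y) mod ?N = d"
      using xy(4) e by (metis mult_mod_right right_diff_distrib)
    ultimately show ?thesis by blast
  next
    case False
    then obtain i where i: "i \<in> {1..?N - 1}" "square11 i"
      "?N dvd i - d \<or> ?N dvd i + d" using n(2) by (elim representative_up_to_sign) auto
    \<comment> \<open>Modulo \<open>11 * n\<close>, \<open>?j - i\<close> is \<open>i\<close>; the
      order of subtraction supplies whichever sign matches \<open>d\<close>.\<close>
    let ?j = "(2 * i) mod ?N"
    have ij: "{i, ?j} \<in> extend n P" using i by (auto simp: extend_def doubling_pairs_def)
    from i(3) show ?thesis
    proof
      assume "?N dvd i - d"
      then have "i mod ?N = d" using d by (rule mod_eq_of_dvd_diff)
      moreover have "(?j - i) mod ?N = i mod ?N" by (simp add: mod_diff_left_eq)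
      ultimately have "(?j - i) mod ?N = d" by simp
      then show ?thesis by (intro bexI[OF _ ij] bexI[of _ ?j] bexI[of _ i]) simp_all
    next
      assume "?N dvd i + d"
      then have "?N dvd - (i + d)" by (simp only: dvd_minus_iff)
      then have "?N dvd (- i) - d" by simp
      then have "(- i) mod ?N = d" using d by (rule mod_eq_of_dvd_diff)
      moreover have "(i - ?j) mod ?N = (- i) mod ?N" by (simp add: mod_diff_right_eq)
      ultimately have "(i - ?j) mod ?N = d" by simp
      then show ?thesis by (intro bexI[OF _ ij] bexI[of _ i] bexI[of _ ?j]) simp_all
    qed
  qed
  then show ?thesis using starter_iff[OF two_partition_extend[OF tp n]] n(2) by auto
qed

lemma sum_doubling_pair:
  fixes i N :: int
  assumes "i \<in> {1..N - 1}"
  shows "(\<Sum>{i, (2 * i) mod N}) mod N = (3 * i) mod N"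
proof -
  \<comment> \<open>The sum over the set has two terms only if its elements differ; otherwise
    \<open>i\<close> would be counted once.\<close>
  have "i \<noteq> (2 * i) mod N" using double_mod_cases[OF assms] assms unfolding atLeastAtMost_iff by linarith
  then have "(\<Sum>{i, (2 * i) mod N}) = i + (2 * i) mod N" by simp
  then show ?thesis by (simp add: mod_add_right_eq)
qed

lemma skew_extend:
  assumes sk: "skew n P" and n: "n \<ge> 3" "\<not> 3 dvd n"
  shows "skew (11 * n) (extend n P)"
proof -
  let ?N = "11 * n"
  have s11: "(\<Sum>((*) 11 ` A)) = 11 * \<Sum>A" for A :: "int set"
    by (subst sum.reindex) (auto simp: inj_on_def sum_distrib_left)
  have nz: "(\<Sum>A) mod ?N \<noteq> 0" if A: "A \<in> extend n P" for A
  proof (cases "A \<in> doubling_pairs ?N")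
    case True
    then obtain i where i: "i \<in> {1..?N - 1}" "square11 i" "A = {i, (2 * i) mod ?N}"
      by (rule doubling_pairE)
    have "\<not> 11 dvd 3 * i" using square11_not_dvd[OF i(2)] by presburger
    then have "\<not> ?N dvd 3 * i" by auto
    then show ?thesis using sum_doubling_pair[OF i(1)] i(3) by (metis mod_0_imp_dvd)
  next
    case False
    then obtain B where B: "B \<in> P" "A = (*) 11 ` B" using A by (auto simp: extend_def)
    have "(\<Sum>B) mod n \<noteq> 0" using sk B(1) n(1) by (simp add: skew_iff)
    then show ?thesis unfolding B(2) s11 by (metis mult_mod_right mult_eq_0_iff zero_neq_numeral)
  qed
  have hit: "\<exists>A\<in>extend n P. (\<Sum>A) mod ?N = d \<or> (- \<Sum>A) mod ?N = d" if d: "d \<in> {1..?N - 1}" for d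
  proof (cases "11 dvd d")
    case True
    then obtain e where e: "d = 11 * e" by blast
    then have "e \<in> {1..n - 1}" using d by auto
    moreover have "n \<ge> 2" using n(1) by simp
    ultimately obtain A where A: "A \<in> P" "(\<Sum>A) mod n = e \<or> (- \<Sum>A) mod n = e"
      using sk unfolding skew_iff[OF \<open>n \<ge> 2\<close>] by blast
    have "(*) 11 ` A \<in> extend n P" using A(1) by (auto simp: extend_def)
    moreover have "(\<Sum>((*) 11 ` A)) mod ?N = d \<or> (- \<Sum>((*) 11 ` A)) mod ?N = d"
      unfolding s11 using A(2) e by (metis mult_mod_right mult_minus_right)
    ultimately show ?thesis by blast
  next
    case False
    \<comment> \<open>Division of \<open>d\<close> by 3 modulo \<open>11 * n\<close>: the inverse of
      3 is \<open>- t\<close> when \<open>11 * n = 3 * t + 1\<close>, and \<open>t\<close> when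
      \<open>11 * n = 3 * t - 1\<close>.\<close>
    obtain e where e: "?N dvd 3 * e - d"
    proof -
      have "3 dvd ?N - 1 \<or> 3 dvd ?N + 1" using n(2) by presburger
      then consider t where "?N = 3 * t + 1" | t where "?N = 3 * t - 1"
        by (metis add_diff_cancel_right' diff_add_cancel dvd_def)
      then show thesis
      proof cases
        case (1 t)
        then have "3 * (- t * d) - d = ?N * (- d)" by algebra
        then show thesis using that by (metis dvd_triv_left)
      next
        case (2 t)
        then have "3 * (t * d) - d = ?N * d" by algebra
        then show thesis using that by (metis dvd_triv_left)
      qed
    qed
    have "\<not> 11 dvd e"
    proof
      assume "11 dvd e"
      moreover have "11 dvd 3 * e - d" using e by (metis dvd_mult_left)
      ultimately show False using False by presburger
    qed
    then obtain i where i: "i \<in> {1..?N - 1}" "square11 i"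
      "?N dvd i - e \<or> ?N dvd i + e" using n(1) by (elim representative_up_to_sign) auto
    let ?A = "{i, (2 * i) mod ?N}"
    have A: "?A \<in> extend n P" using i by (auto simp: extend_def doubling_pairs_def)
    note s = sum_doubling_pair[OF i(1)]
    have s': "(- \<Sum>?A) mod ?N = (- (3 * i)) mod ?N" using s by (metis mod_minus_eq)
    from i(3) have "?N dvd 3 * i - d \<or> ?N dvd - (3 * i) - d"
    proof
      assume "?N dvd i - e"
      then have "?N dvd 3 * (i - e) + (3 * e - d)" using e by (metis dvd_add dvd_mult)
      then show ?thesis by (simp add: algebra_simps)
    next
      assume "?N dvd i + e"
      then have "?N dvd (3 * e - d) - 3 * (i + e)" using e by (metis dvd_diff dvd_mult)
      moreover have "(3 * e - d) - 3 * (i + e) = - (3 * i) - d" by simp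
      ultimately have "?N dvd - (3 * i) - d" by (simp only:)
      then show ?thesis ..
    qed
    then have "(3 * i) mod ?N = d \<or> (- (3 * i)) mod ?N = d" using mod_eq_of_dvd_diff[OF _ d] by blast
    then show ?thesis using A s s' by (metis (no_types))
  qed
  show ?thesis using nz hit n(1) by (simp add: skew_iff)
qed

lemma skolem_extend:
  assumes sk: "skolem n P" and n: "odd n"
  shows "skolem (11 * n) (extend n P)"
  unfolding skolem_def
proof (intro allI impI; elim conjE)
  fix x y assume xy: "{x, y} \<in> extend n P" "x < y"
  show "y - x \<le> (11 * n - 1) div 2"
  proof (cases "{x, y} \<in> doubling_pairs (11 * n)")
    case True
    then obtain i where i: "i \<in> {1..11 * n - 1}" "{x, y} = {i, (2 * i) mod (11 * n)}"
      by (rule doubling_pairE)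
    then have "x = i \<and> y = (2 * i) mod (11 * n) \<or> y = i \<and> x = (2 * i) mod (11 * n)"
      by (auto simp: doubleton_eq_iff)
    \<comment> \<open>With no wraparound the larger element is the double and the difference is
      \<open>i\<close>; with wraparound the larger is \<open>i\<close> and the difference is
      \<open>11 * n - i\<close>. Either one is less than half of the odd
      \<open>11 * n\<close>.\<close>
    then have "y - x \<le> i \<and> 2 * i < 11 * n \<or> y - x \<le> 11 * n - i \<and> 11 * n \<le> 2 * i"
      using double_mod_cases[OF i(1)] i(1) xy(2) unfolding atLeastAtMost_iff by linarith
    then show ?thesis using n by presburger
  next
    case False
    then obtain B where B: "B \<in> P" "{x, y} = (*) 11 ` B" using xy(1) by (auto simp: extend_def)
    then have "x \<in> (*) 11 ` B" "y \<in> (*) 11 ` B" by (metis insertI1 insertI2)+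
    then obtain u v where uv: "u \<in> B" "v \<in> B" "x = 11 * u" "y = 11 * v" by (elim imageE)
    have "z \<in> {u, v}" if "z \<in> B" for z
    proof -
      have "11 * z \<in> {x, y}" unfolding B(2) using that by (rule imageI)
      then show ?thesis using uv by simp
    qed
    then have "B = {u, v}" using uv by blast
    then have "v - u \<le> (n - 1) div 2" using sk B(1) uv xy(2) by (auto simp: skolem_def)
    \<comment> \<open>Scaling the old bound gives \<open>11 * ((n - 1) div 2)\<close>, which is 5
      below the new one.\<close>
    then show ?thesis using uv n by auto
  qed
qed

text \<open>Doubling commutes with scaling by 11, also after reduction, and scaling is injective. So
  if every scaled pair had the form \<open>{j, 2j}\<close>, every pair of \<open>P\<close> would
  have that form modulo \<open>n\<close>.\<close>

lemma not_cardioidal_extend: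
  assumes "\<not> cardioidal n P"
  shows "\<not> cardioidal (11 * n) (extend n P)"
proof
  assume c: "cardioidal (11 * n) (extend n P)"
  have "\<exists>i\<in>nonzero_residues n. A = {i, (2 * i) mod n}" if "A \<in> P" for A
  proof -
    have "(*) 11 ` A \<in> extend n P" using that by (auto simp: extend_def)
    then obtain j where j: "j \<in> {1..11 * n - 1}" "(*) 11 ` A = {j, (2 * j) mod (11 * n)}"
      using c by (auto simp: cardioidal_def nonzero_residues_def)
    then obtain i where i: "j = 11 * i" by auto
    have "(2 * j) mod (11 * n) = 11 * ((2 * i) mod n)" unfolding i by (simp add: mult_mod_right algebra_simps)
    then have "(*) 11 ` A = (*) 11 ` {i, (2 * i) mod n}" using j(2) i by simp
    then have "A = {i, (2 * i) mod n}" by (subst (asm) inj_image_eq_iff) (auto simp: inj_def)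
    moreover have "i \<in> nonzero_residues n" using j(1) i by (auto simp: nonzero_residues_def)
    ultimately show ?thesis by blast
  qed
  then show False using assms(1) by (auto simp: cardioidal_def)
qed

lemma skew_skolem_noncard_extend:
  assumes "skew_skolem_noncard n P"
  shows "skew_skolem_noncard (11 * n) (extend n P)"
proof -
  have "\<not> 3 dvd n" using assms by (simp add: skew_skolem_noncard_def)
  then have "\<not> 3 dvd 11 * n" by presburger
  then show ?thesis
    using assms starter_extend skew_extend skolem_extend not_cardioidal_extend
    by (auto simp: skew_skolem_noncard_def skew_skolem_starter_def)
qed

section \<open>The initial starter of order 17\<close>

text \<open>The pairs are listed by their integer differences 8, 7, ..., 1. Their sums modulo 17
  are, up to sign, 7, 2, 1, 8, 3, 6, 4, 5.\<close>

definition base :: "int set set" where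
  "base = {{1, 9}, {6, 13}, {5, 11}, {10, 15}, {8, 12}, {4, 7}, {14, 16}, {2, 3}}"

lemma interval17: "{1..16} = {1, 2, 3, 4, 5, 6, 7, 8, 9, 10, 11, 12, 13, 14, 15, 16 :: int}"
  by (simp add: upto.simps flip: set_upto)

lemma skew_skolem_noncard_base: "skew_skolem_noncard 17 base"
proof -
  have "\<Union>base = {1..16}"
    unfolding interval17 base_def Union_insert Union_empty by (intro subset_antisym) simp_all
  moreover have "disjoint base"
  proof (rule disjointI)
    fix A B assume "A \<in> base" "B \<in> base" "A \<noteq> B"
    then show "A \<inter> B = {}" unfolding base_def by (elim insertE emptyE; hypsubst; simp)
  qed
  ultimately have tp: "two_partition 17 base"
    by (auto simp: two_partition_def nonzero_residues_def partition_on_def base_def)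
  have "starter 17 base"
    unfolding starter_iff[OF tp, simplified] interval17 by (simp add: base_def)
  moreover have "skew 17 base"
    using skew_iff[of 17 base] interval17 by (simp add: base_def)
  moreover have "skolem 17 base"
    by (auto simp: skolem_def base_def doubleton_eq_iff)
  moreover have "\<not> cardioidal 17 base"
  proof
    assume "cardioidal 17 base"
    \<comment> \<open>This pair is the obstruction: modulo 17, doubling 6 gives 12 and doubling 13
      gives 9. The pairs \<open>{1, 9}\<close> and \<open>{5, 11}\<close> would not do, as 9 doubles
      to 1 and 11 to 5.\<close>
    then obtain i :: int where "{6, 13} = {i, (2 * i) mod 17}"
      unfolding cardioidal_def base_def by blast
    then show False by (auto simp: doubleton_eq_iff)
  qed
  ultimately show ?thesis by (simp add: skew_skolem_noncard_def skew_skolem_starter_def)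
qed

section \<open>Infinitely many orders\<close>

lemma ex_skew_skolem_noncard: "\<exists>P. skew_skolem_noncard (11 ^ k * 17) P"
proof (induction k)
  case 0
  then show ?case using skew_skolem_noncard_base by auto
next
  case (Suc k)
  then show ?case using skew_skolem_noncard_extend by (metis mult.assoc power_Suc)
qed

text \<open>The orders \<open>11 ^ k * 17\<close> are pairwise distinct, so already the projection
  of \<open>S\<close> to orders is infinite. Leaving \<open>S\<close> abstract serves both the
  strong and the skew claim.\<close>

lemma infinite_orders:
  assumes "\<And>n P. skew_skolem_noncard n P \<Longrightarrow> (n, P) \<in> S"
  shows "infinite S"
proof
  assume "finite S"
  moreover have "range (\<lambda>k::nat. 11 ^ k * 17 :: int) \<subseteq> fst ` S"
  proof clarify
    fix k :: nat
    obtain P where "skew_skolem_noncard (11 ^ k * 17) P" using ex_skew_skolem_noncard by blast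
    then have "(11 ^ k * 17, P) \<in> S" by (rule assms)
    then show "11 ^ k * 17 \<in> fst ` S" by (metis fst_conv imageI)
  qed
  ultimately have "finite (range (\<lambda>k::nat. 11 ^ k * 17 :: int))"
    by (metis finite_imageI finite_subset)
  moreover have "inj (\<lambda>k::nat. 11 ^ k * 17 :: int)" by (auto simp: inj_def)
  ultimately show False using finite_imageD by blast
qed

theorem theorem4p2:
  "infinite {(n, P). odd n \<and> n \<ge> 3 \<and> strong_skolem_starter n P \<and> \<not> cardioidal n P} \<and>
   infinite {(n, P). odd n \<and> n \<ge> 3 \<and> skew_skolem_starter n P \<and> \<not> cardioidal n P}"
proof (intro conjI infinite_orders)
  fix n P assume *: "skew_skolem_noncard n P"
  then show "(n, P) \<in> {(n, P). odd n \<and> n \<ge> 3 \<and> skew_skolem_starter n P \<and> \<not> cardioidal n P}"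
    by (simp add: skew_skolem_noncard_def)
  \<comment> \<open>Skewness forces strength, so the same family witnesses the strong claim.\<close>
  have "strong n P"
    using * by (intro skew_imp_strong)
      (auto simp: skew_skolem_noncard_def skew_skolem_starter_def starter_def)
  then show "(n, P) \<in> {(n, P). odd n \<and> n \<ge> 3 \<and> strong_skolem_starter n P \<and> \<not> cardioidal n P}"
    using * by (simp add: skew_skolem_noncard_def skew_skolem_starter_def strong_skolem_starter_def)
qed

end
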